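(* For any $n\in\mathbb N$, $u^*\in\mathbb R_{\ge 0}$ and any configuration $C\in\mathrm{CONF}(n,u^* )$ we have $\mathrm{val}(C)\le u^*+\frac{1}{6}(n-u^* )$.
   Context: A configuration of size $m$ is a triple $(x,l,u)$ of functions $x,l,u:\{1,\dots,m\}\to\mathbb R_{\ge 0}$ such that for all $i$: $0<x_i\le 1$; $l_i\le 2-x_i$; and $u_i>0$ implies $l_i=2-x_i$. The $i$-th element uses $e_i=\lceil (l_i+u_i)/x_i\rceil$ edges, and the configuration uses $\sum_i e_i$ edges. Its value is $\mathrm{val}(x,l,u)=\sum_{i}\max(0,l_i+u_i-1)$. $\mathrm{CONF}(n,u^* )$ denotes the set of all configurations (of any size) using at most $n$ edges with $\sum_i u_i=u^*$. *)

theory Defs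
  imports Complex_Main
begin

text \<open>
  A configuration is encoded as a tuple \<open>(m, x, l, u)\<close> that carries its size \<open>m\<close> explicitly.
  The three functions are total on \<open>nat\<close>; only their values on \<open>{1..m}\<close> are constrained, and
  nothing below depends on any other value.
\<close>

type_synonym configuration = "nat \<times> (nat \<Rightarrow> real) \<times> (nat \<Rightarrow> real) \<times> (nat \<Rightarrow> real)"

fun is_configuration :: "configuration \<Rightarrow> bool" where
  "is_configuration (m, x, l, u) \<longleftrightarrow>
     (\<forall>i\<in>{1..m}. 0 \<le> x i \<and> 0 \<le> l i \<and> 0 \<le> u i \<and>
        0 < x i \<and> x i \<le> 1 \<and>
        l i \<le> 2 - x i \<and>
        (u i > 0 \<longrightarrow> l i = 2 - x i))"

fun element_edges :: "configuration \<Rightarrow> nat \<Rightarrow> int" where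
  "element_edges (m, x, l, u) i = \<lceil>(l i + u i) / x i\<rceil>"

fun edges_used :: "configuration \<Rightarrow> int" where
  "edges_used (m, x, l, u) = (\<Sum>i=1..m. element_edges (m, x, l, u) i)"

fun config_val :: "configuration \<Rightarrow> real" where
  "config_val (m, x, l, u) = (\<Sum>i=1..m. max 0 (l i + u i - 1))"

fun u_total :: "configuration \<Rightarrow> real" where
  "u_total (m, x, l, u) = (\<Sum>i=1..m. u i)"

definition CONF :: "nat \<Rightarrow> real \<Rightarrow> configuration set" where
  "CONF n ustar = {C. is_configuration C \<and> edges_used C \<le> int n \<and> u_total C = ustar}"

end

theory Submission
  imports Defs
begin

text \<open>
  The bound holds element by element. If an element uses \<open>e\<close> edges then \<open>l + u \<le> e x\<close>, and together
  with \<open>l \<le> 2 - x\<close> this makes the claim \<open>6 (l - 1) + u \<le> e\<close> linear in \<open>x\<close>, \<open>l\<close>, \<open>u\<close> for every fixed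
  \<open>e\<close>. For large \<open>e\<close> it follows from \<open>x \<le> 1\<close>; for small \<open>e\<close> the extreme point \<open>x = 2 / (e + 1)\<close>
  reduces it to \<open>(e - 2) (e - 3) \<ge> 0\<close>, which is where the integrality of \<open>e\<close> enters and where the
  constant \<open>1 / 6\<close> comes from.
\<close>

lemma element_val_le:
  fixes x l u :: real and e :: int
  assumes x: "0 < x" "x \<le> 1" and lu: "0 \<le> l" "0 \<le> u" "l \<le> 2 - x" "u > 0 \<longrightarrow> l = 2 - x"
    and e: "e = \<lceil>(l + u) / x\<rceil>"
  shows "max 0 (l + u - 1) \<le> u + 1 / 6 * (real_of_int e - u)"
proof -
  have "(l + u) / x \<le> real_of_int e"
    unfolding e by simp
  then have ex: "l + u \<le> real_of_int e * x"
    using x by (simp add: pos_divide_le_eq)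
  have "0 \<le> (l + u) / x"
    using x lu by simp
  then have e0: "0 \<le> e"
    unfolding e by linarith
  \<comment> \<open>Six times the goal for the branch \<open>l + u - 1\<close> of the
    \<open>max\<close>, rearranged; the branch \<open>0\<close> follows from
    \<open>0 \<le> e\<close> and \<open>0 \<le> u\<close>.\<close>
  have "6 * (l - 1) + u \<le> real_of_int e"
  \<comment> \<open>From \<open>l \<le> 2 - x\<close> and \<open>l + u \<le> e x\<close> the left
    side is at most \<open>4 + (e - 5) x\<close>. For \<open>e > 5\<close> this increases in
    \<open>x\<close>, so \<open>x = 1\<close> is the worst case and gives
    \<open>e - 1\<close>.\<close>
  proof (cases "e \<le> 5")
    case True
    with e0 have "e \<in> {0, 1, 2, 3, 4, 5}"
      by auto
    then show ?thesis
      using ex x lu by auto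
  next
    case False
    then have "(real_of_int e - 5) * x \<le> real_of_int e - 5"
      using x by (intro mult_left_le) auto
    then have "real_of_int e * x \<le> real_of_int e - 5 + 5 * x"
      by (simp add: algebra_simps)
    moreover have "6 \<le> real_of_int e"
      using False by linarith
    ultimately show ?thesis
      using ex x lu by (cases "u > 0") auto
  qed
  moreover have "0 \<le> real_of_int e"
    using e0 by simp
  ultimately show ?thesis
    using lu(2) by (auto simp: max_def field_simps)
qed

theorem theorem6:
  fixes n :: nat and ustar :: real and C :: configuration
  assumes "0 \<le> ustar"
    and "C \<in> CONF n ustar"
  shows "config_val C \<le> ustar + 1 / 6 * (real n - ustar)"
proof -
  obtain m x l u where C: "C = (m, x, l, u)"
    by (cases C)
  define e where "e = element_edges C"
  have conf: "is_configuration C" and total: "ustar = (\<Sum>i=1..m. u i)"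
    and "(\<Sum>i=1..m. e i) \<le> int n"
    using assms(2) by (auto simp: CONF_def C e_def)
  then have edges: "(\<Sum>i=1..m. real_of_int (e i)) \<le> real n"
    by (simp flip: of_int_sum)
  have "config_val C \<le> (\<Sum>i=1..m. u i + 1 / 6 * (real_of_int (e i) - u i))"
    unfolding C config_val.simps
    by (intro sum_mono element_val_le) (use conf in \<open>auto simp: C e_def\<close>)
  \<comment> \<open>The bound per element is affine in \<open>e i\<close> and \<open>u i\<close>, so
    its sum depends only on their totals.\<close>
  also have "\<dots> = ustar + 1 / 6 * ((\<Sum>i=1..m. real_of_int (e i)) - ustar)"
    by (simp add: total sum.distrib sum_subtractf flip: sum_divide_distrib)
  also have "\<dots> \<le> ustar + 1 / 6 * (real n - ustar)"
    using edges by simp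
  finally show ?thesis .
qed

end
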